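(* Let $t_n=(-1)^{s_2(n)}$, $h_0=0$, $h_1=1$, and $h_n=t_nh_{n-1}+h_{n-2}$ for $n\ge2$. For each integer $m\ge 2$ the congruence $h_n\equiv 0\pmod m$ has infinitely many solutions $n\in\mathbb{N}_{+}$.
   Context: $s_2(n)$ denotes the number of 1's in the binary expansion of $n$; $(t_n)$ is the Prouhet–Thue–Morse sequence. *)

theory Defs
  imports Main "HOL-Number_Theory.Cong"
begin

definition binary_digit_sum :: "nat \<Rightarrow> nat" where
  "binary_digit_sum n = card {i. bit n i}"

definition thue_morse :: "nat \<Rightarrow> int" where
  "thue_morse n = (- 1) ^ binary_digit_sum n"

fun tm_fib :: "nat \<Rightarrow> int" where
  "tm_fib 0 = 0"
| "tm_fib (Suc 0) = 1"
| "tm_fib (Suc (Suc n)) = thue_morse (Suc (Suc n)) * tm_fib (Suc n) + tm_fib n"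

end

theory Submission
  imports Defs "HOL-Combinatorics.Cycles" "HOL-Library.Infinite_Set"
begin

text \<open>
  The pair \<open>(h\<^sub>n, h\<^sub>n\<^sub>-\<^sub>1)\<close> modulo \<open>m\<close> is obtained from \<open>(0, 1)\<close> by applying \<open>n\<close> permutations of a
  finite set, the \<open>i\<close>-th being determined by \<open>t\<^sub>i\<close>. The Thue--Morse word is recurrent, as
  \<open>t\<^bsub>3\<cdot>2^k + i\<^esub> = t\<^sub>i\<close> for \<open>i < 2^k\<close>. Recurrence lifts to extensions by a finite group: by
  pigeonhole some permutation \<open>g\<close> is the product over prefixes after which arbitrarily long prefixes
  reappear; concatenating such prefixes shows that every power of \<open>g\<close>, hence the identity,
  has the same property.
\<close>

primrec prefix_action :: "('a \<Rightarrow> 's \<Rightarrow> 's) \<Rightarrow> (nat \<Rightarrow> 'a) \<Rightarrow> nat \<Rightarrow> 's \<Rightarrow> 's" where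
  "prefix_action act w 0 = id"
| "prefix_action act w (Suc n) = act (w n) \<circ> prefix_action act w n"

lemma prefix_action_add:
  assumes "\<And>i. i < k \<Longrightarrow> w (n + i) = w i"
  shows "prefix_action act w (n + k) = prefix_action act w k \<circ> prefix_action act w n"
  using assms by (induction k) (auto simp: comp_assoc)

lemma prefix_action_permutes:
  assumes "\<And>a. act a permutes S"
  shows "prefix_action act w n permutes S"
  using assms by (induction n) (auto intro: permutes_compose simp: permutes_id)

lemma infinite_prefix_action_id:
  assumes fin: "finite S"
    and perm: "\<And>a. act a permutes S"
    and rec: "\<And>L. \<exists>n\<ge>L. \<forall>i<L. w (n + i) = w i"
  shows "infinite {n. prefix_action act w n = id}"
proof -
  let ?G = "prefix_action act w"
  \<comment> \<open>The bound \<open>n \<ge> L\<close> makes the returns arbitrarily late, so that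
    \<open>R id\<close> yields infinitely many \<open>n\<close>.\<close>
  define R where "R g \<longleftrightarrow> (\<forall>L. \<exists>n\<ge>L. (\<forall>i<L. w (n + i) = w i) \<and> ?G n = g)" for g
  obtain r where r: "\<And>L. r L \<ge> L" "\<And>L i. i < L \<Longrightarrow> w (r L + i) = w i"
    using rec by metis
  have "finite (range (\<lambda>L. ?G (r L)))"
    by (rule finite_subset[OF _ finite_permutations[OF fin]])
      (use prefix_action_permutes[of act S] perm in blast)
  then obtain L0 where L0: "infinite {L. ?G (r L) = ?G (r L0)}"
    using pigeonhole_infinite[of "UNIV :: nat set" "\<lambda>L. ?G (r L)"] by auto
  define g where "g = ?G (r L0)"
  have R_g: "R g"
    unfolding R_def
  proof
    fix L
    obtain L' where "L' \<ge> L" "?G (r L') = g"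
      using L0 unfolding g_def infinite_nat_iff_unbounded_le by blast
    with r[of L'] show "\<exists>n\<ge>L. (\<forall>i<L. w (n + i) = w i) \<and> ?G n = g"
      by (intro exI[of _ "r L'"]) (auto intro: r(2))
  qed
  have R_comp: "R (f \<circ> f')" if "R f" "R f'" for f f'
    unfolding R_def
  proof
    fix L
    obtain k where k: "k \<ge> L" "\<forall>i<L. w (k + i) = w i" "?G k = f"
      using \<open>R f\<close> unfolding R_def by blast
    \<comment> \<open>Matching \<open>k + L\<close> letters lets the first \<open>k\<close> of them
      contribute \<open>f\<close> after \<open>f'\<close>, while the next \<open>L\<close> copy the
      letters at \<open>k\<close>, hence the prefix.\<close>
    obtain n where n: "n \<ge> k + L" "\<forall>i<k + L. w (n + i) = w i" "?G n = f'"
      using \<open>R f'\<close> unfolding R_def by blast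
    have "?G (n + k) = f \<circ> f'"
      using prefix_action_add[of k w n act] k n by auto
    moreover have "w (n + k + i) = w i" if "i < L" for i
      using n(2) k(2) that by (simp add: add.assoc)
    ultimately show "\<exists>n\<ge>L. (\<forall>i<L. w (n + i) = w i) \<and> ?G n = f \<circ> f'"
      using k(1) by (intro exI[of _ "n + k"]) auto
  qed
  \<comment> \<open>Only positive powers: \<open>R id\<close> is not known in advance and comes from
    the finite order of \<open>g\<close>.\<close>
  have R_pow: "R (g ^^ Suc j)" for j
  proof (induction j)
    case (Suc j)
    from R_comp[OF R_g this] show ?case
      by (simp only: funpow.simps)
  qed (use R_g in simp)
  have "g permutes S"
    unfolding g_def using perm by (rule prefix_action_permutes)
  then obtain j where "j > 0" "g ^^ j = id"
    using fin permutation_is_nilpotent permutation_permutes by metis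
  then have "R id"
    using R_pow[of "j - 1"] by simp
  then show ?thesis
    by (auto simp: R_def infinite_nat_iff_unbounded_le)
qed

lemma bit_less_if_less_power:
  fixes i :: nat
  assumes "i < 2 ^ k" "bit i j"
  shows "j < k"
proof (rule ccontr)
  assume "\<not> j < k"
  then have "(2::nat) ^ k \<le> 2 ^ j"
    by simp
  with assms(1) have "i div 2 ^ j = 0"
    by (intro div_less) linarith
  with assms(2) show False
    by (simp add: bit_iff_odd)
qed

text \<open>Bit \<open>k\<close> of \<open>i\<close> is clear, so the addition sets it without a
  carry.\<close>

lemma binary_digit_sum_add_power:
  assumes "i < 2 ^ k"
  shows "binary_digit_sum (2 ^ k + i) = Suc (binary_digit_sum i)"
proof -
  have nk: "\<not> bit i k"
    using bit_less_if_less_power[OF assms] by blast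
  then have "2 ^ k + i = set_bit k i"
    by (simp add: set_bit_eq)
  then have "{j. bit (2 ^ k + i) j} = insert k {j. bit i j}"
    by (auto simp: bit_set_bit_iff)
  moreover have "finite {j. bit i j}"
    by (rule finite_subset[of _ "{..<k}"]) (use bit_less_if_less_power[OF assms] in auto)
  ultimately show ?thesis
    using nk by (simp add: binary_digit_sum_def)
qed

text \<open>Since 3 * 2^k = 2^(k+1) + 2^k, two new binary ones appear and the sign is
  unchanged.\<close>

lemma thue_morse_shift:
  assumes "i < 2 ^ k"
  shows "thue_morse (3 * 2 ^ k + i) = thue_morse i"
proof -
  have "binary_digit_sum (2 ^ Suc k + (2 ^ k + i)) = Suc (Suc (binary_digit_sum i))"
    using assms binary_digit_sum_add_power[of "2 ^ k + i" "Suc k"]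
    by (simp add: binary_digit_sum_add_power)
  moreover have "3 * 2 ^ k + i = 2 ^ Suc k + (2 ^ k + i)"
    by simp
  ultimately show ?thesis
    by (simp only: thue_morse_def power_Suc mult_minus1 minus_minus)
qed

text \<open>One step of the recurrence on pairs of residues, extended by the identity so that it is
  a permutation in the sense of \<open>permutes\<close>.\<close>

definition fib_step :: "int \<Rightarrow> int \<Rightarrow> int \<times> int \<Rightarrow> int \<times> int" where
  "fib_step m a z =
    (if z \<in> {0..<m} \<times> {0..<m} then ((a * fst z + snd z) mod m, fst z) else z)"

text \<open>The output keeps \<open>fst z\<close>, and \<open>snd z\<close> enters with coefficient
  1, so it can be recovered for any \<open>a\<close>; finiteness then gives surjectivity.\<close>

lemma fib_step_permutes: "fib_step m a permutes {0..<m} \<times> {0..<m}"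
proof (rule bij_imp_permutes)
  let ?S = "{0..<m} \<times> {0..<m}"
  have "inj_on (fib_step m a) ?S"
  proof (rule inj_onI)
    fix z z' assume z: "z \<in> ?S" "z' \<in> ?S" and eq: "fib_step m a z = fib_step m a z'"
    then have fst: "fst z = fst z'"
      and "(a * fst z + snd z) mod m = (a * fst z' + snd z') mod m"
      by (auto simp: fib_step_def)
    then have "[a * fst z + snd z = a * fst z + snd z'] (mod m)"
      by (simp add: cong_def)
    then have "[snd z = snd z'] (mod m)"
      by (simp add: cong_add_lcancel)
    then have "snd z = snd z'"
      using z by (auto simp: cong_def)
    with fst show "z = z'"
      by (simp add: prod_eq_iff)
  qed
  moreover have "fib_step m a ` ?S \<subseteq> ?S"
    by (auto simp: fib_step_def)
  ultimately show "bij_betw (fib_step m a) ?S ?S"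
    by (simp add: bij_betw_def endo_inj_surj)
qed (simp add: fib_step_def)

text \<open>The start (0, 1) acts as (h_0, h_{-1}) with h_{-1} = 1: the first step gives (1, 0)
  whatever its sign. The letter at index \<open>i\<close> is t_{i+1}, hence the shifted
  word.\<close>

lemma prefix_action_fib_step:
  assumes "m \<ge> 2"
  shows "prefix_action (fib_step m) (\<lambda>i. thue_morse (Suc i)) (Suc n) (0, 1)
    = (tm_fib (Suc n) mod m, tm_fib n mod m)"
proof (induction n)
  case 0
  show ?case
    using assms by (simp add: fib_step_def)
next
  case (Suc n)
  have "prefix_action (fib_step m) (\<lambda>i. thue_morse (Suc i)) (Suc (Suc n)) (0, 1)
      = fib_step m (thue_morse (Suc (Suc n))) (tm_fib (Suc n) mod m, tm_fib n mod m)"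
    using Suc.IH by simp
  also have "\<dots> = (tm_fib (Suc (Suc n)) mod m, tm_fib (Suc n) mod m)"
    using assms
    by (simp add: fib_step_def, metis mod_add_left_eq mod_add_right_eq mod_mult_right_eq)
  finally show ?case .
qed

theorem theorem2:
  fixes m :: int
  assumes "m \<ge> 2"
  shows "infinite {n :: nat. n > 0 \<and> [tm_fib n = 0] (mod m)}"
proof -
  let ?w = "\<lambda>i. thue_morse (Suc i)"
  let ?I = "{n. prefix_action (fib_step m) ?w n = id}"
  have "\<exists>n\<ge>L. \<forall>i<L. ?w (n + i) = ?w i" for L
  proof (intro exI conjI allI impI)
    have L: "L < 2 ^ L"
      by (rule less_exp)
    then show "L \<le> 3 * 2 ^ L"
      by linarith
    \<comment> \<open>The shifted word needs \<open>Suc i < 2 ^ L\<close>, which follows from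
      \<open>Suc i \<le> L < 2 ^ L\<close>.\<close>
    show "?w (3 * 2 ^ L + i) = ?w i" if "i < L" for i
      using thue_morse_shift[of "Suc i" L] L that by simp
  qed
  then have "infinite ?I"
    by (intro infinite_prefix_action_id[of "{0..<m} \<times> {0..<m}"] fib_step_permutes) auto
  then have "infinite (?I - {0})"
    by simp
  moreover have "?I - {0} \<subseteq> {n. n > 0 \<and> [tm_fib n = 0] (mod m)}"
  proof
    fix n assume n: "n \<in> ?I - {0}"
    then obtain n' where n': "n = Suc n'"
      using not0_implies_Suc by auto
    \<comment> \<open>The identity fixes (0, 1), so the first coordinate
      \<open>tm_fib n mod m\<close> is 0.\<close>
    show "n \<in> {n. n > 0 \<and> [tm_fib n = 0] (mod m)}"
      using prefix_action_fib_step[OF assms, of n'] n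
      unfolding n' by (simp add: cong_def del: prefix_action.simps)
  qed
  ultimately show ?thesis
    using finite_subset by blast
qed

end
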